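(* Let $p(x,\theta)=e^{\theta\cdot T(x)-\psi(\theta)}$ be a minimal $n$-dimensional exponential family, let $q(y,\theta)$ be the corresponding incomplete data density at the observed datum $y$, and let $M\subset\overline\Theta$ be a closed constraint set (see context). Suppose that $-\log q(y,\cdot)$ and $M$ are definable. Let $\theta^{(k)}\in M$ be a bounded sequence generated by the constrained EM algorithm $\theta^{(k+1)}\in\mathrm{argmin}_{\theta\in M}\,-\mathbb E_{\theta^{(k)}}(\log p(x,\theta)|y)$, which together with its accumulation points stays in $G=\mathrm{int}(\Theta)$. Let $\theta'^*=\lim_k P\theta^{(k)}$ be the limit of the accurate parameters, and suppose that the set $M(\theta'^* )=\{\theta''\in V^\perp:\theta'^*+\theta''\in M\}$ is convex. Then the EM sequence $\theta^{(k)}$ converges.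
   Context: $X$ is the complete data space with $\sigma$-finite measure $\mu$; $h:X\to Y$ is measurable, $\nu=\mu\circ h^{-1}$, and $(\mu_y)_{y\in Y}$ is a disintegration of $\mu$ with respect to $\nu$: each $\mu_y$ is concentrated on $h^{-1}(y)$ and $\int_X f\,d\mu=\int_Y\int_{h^{-1}(y)}f\,d\mu_y\,d\nu(y)$. Exponential family: $T:X\to\mathbb R^n$ measurable, $\psi(\theta)=\log\int_Xe^{\theta\cdot T(x)}d\mu(x)$, $\Theta=\{\theta\in\mathbb R^n:\int_X e^{\theta\cdot T}d\mu<\infty\}$ assumed of full dimension $n$, $G=\mathrm{int}(\Theta)$, $p(x,\theta)=e^{\theta\cdot T(x)-\psi(\theta)}$. It is minimal if there is no $a\ne0$ with $a\cdot T(x)$ constant for $\mu$-a.a. $x$. Fix an observed $y\in Y$. $q(y,\theta)=\int_{h^{-1}(y)}p(x,\theta)d\mu_y(x)$, assumed positive and finite for $\theta\in\Theta$; $k(x|y,\theta)=p(x,\theta)/q(y,\theta)$; $\mathbb E_\theta(\cdot|y)$ is expectation under $k(\cdot|y,\theta)d\mu_y$. Accurate and spare parameters: let $t_0+V$ ($V$ a linear subspace, $t_0\in V^\perp$) be the smallest affine subspace of $\mathbb R^n$ containing $T(x)$ for $\mu_y$-a.a. $x\in h^{-1}(y)$, and $P$ the orthogonal projection onto $V$. Write $\theta=\theta'+\theta''$, identified with $(\theta',\theta'')$, where $\theta'=P\theta\in V$ is the accurate parameter and $\theta''=(I-P)\theta\in V^\perp$ the spare parameter. Under the stated hypotheses (without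 convexity) the sequence $\theta'^{(k)}=P\theta^{(k)}$ is known to converge. Definable means definable in a fixed o-minimal structure expanding the real field (e.g. $\mathbb R_{an}$ or $\mathbb R_{an,\exp}$). *)

theory Defs
  imports "HOL-Probability.Probability"
begin

text \<open>\<open>\<kappa> y\<close> is the measure on the fibre \<open>h -` {y}\<close>, viewed as a measure on the whole data
  space giving no mass to the complement of the fibre. Integrals over the fibre are therefore
  plain integrals with respect to \<open>\<kappa> y\<close>.\<close>

definition disintegration ::
    "'a measure \<Rightarrow> 'b measure \<Rightarrow> ('a \<Rightarrow> 'b) \<Rightarrow> ('b \<Rightarrow> 'a measure) \<Rightarrow> bool" where
  "disintegration \<mu> N h \<kappa> \<longleftrightarrow>
     (\<forall>y\<in>space N. sets (\<kappa> y) = sets \<mu> \<and> (AE x in \<kappa> y. h x = y)) \<and>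
     (\<forall>f :: 'a \<Rightarrow> ennreal. f \<in> borel_measurable \<mu> \<longrightarrow>
        (\<lambda>y. \<integral>\<^sup>+x. f x \<partial>\<kappa> y) \<in> borel_measurable N \<and>
        (\<integral>\<^sup>+x. f x \<partial>\<mu>) = (\<integral>\<^sup>+y. (\<integral>\<^sup>+x. f x \<partial>\<kappa> y) \<partial>distr \<mu> N h))"


definition natural_params :: "'a measure \<Rightarrow> ('a \<Rightarrow> real ^ 'n) \<Rightarrow> (real ^ 'n) set" where
  "natural_params \<mu> T = {\<theta>. (\<integral>\<^sup>+x. ennreal (exp (\<theta> \<bullet> T x)) \<partial>\<mu>) < \<infinity>}"

text \<open>Meaningful on \<^term>\<open>natural_params \<mu> T\<close> only; outside, \<open>\<psi>\<close> is \<open>\<infinity>\<close> on paper.\<close>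

definition log_partition :: "'a measure \<Rightarrow> ('a \<Rightarrow> real ^ 'n) \<Rightarrow> real ^ 'n \<Rightarrow> real" where
  "log_partition \<mu> T \<theta> = ln (\<integral>x. exp (\<theta> \<bullet> T x) \<partial>\<mu>)"

definition exp_density :: "'a measure \<Rightarrow> ('a \<Rightarrow> real ^ 'n) \<Rightarrow> 'a \<Rightarrow> real ^ 'n \<Rightarrow> real" where
  "exp_density \<mu> T x \<theta> = exp (\<theta> \<bullet> T x - log_partition \<mu> T \<theta>)"

definition minimal_family :: "'a measure \<Rightarrow> ('a \<Rightarrow> real ^ 'n) \<Rightarrow> bool" where
  "minimal_family \<mu> T \<longleftrightarrow> \<not> (\<exists>a. a \<noteq> 0 \<and> (\<exists>c. AE x in \<mu>. a \<bullet> T x = c))"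


definition incomplete_density ::
    "'a measure \<Rightarrow> ('b \<Rightarrow> 'a measure) \<Rightarrow> ('a \<Rightarrow> real ^ 'n) \<Rightarrow> 'b \<Rightarrow> real ^ 'n \<Rightarrow> ennreal" where
  "incomplete_density \<mu> \<kappa> T y \<theta> = (\<integral>\<^sup>+x. ennreal (exp_density \<mu> T x \<theta>) \<partial>\<kappa> y)"

definition neg_log_incomplete_density ::
    "'a measure \<Rightarrow> ('b \<Rightarrow> 'a measure) \<Rightarrow> ('a \<Rightarrow> real ^ 'n) \<Rightarrow> 'b \<Rightarrow> real ^ 'n \<Rightarrow> real" where
  "neg_log_incomplete_density \<mu> \<kappa> T y \<theta> = - ln (enn2real (incomplete_density \<mu> \<kappa> T y \<theta>))"

definition cond_density ::
    "'a measure \<Rightarrow> ('b \<Rightarrow> 'a measure) \<Rightarrow> ('a \<Rightarrow> real ^ 'n) \<Rightarrow> 'b \<Rightarrow> real ^ 'n \<Rightarrow> 'a \<Rightarrow> real" where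
  "cond_density \<mu> \<kappa> T y \<theta> x =
     exp_density \<mu> T x \<theta> / enn2real (incomplete_density \<mu> \<kappa> T y \<theta>)"

definition cond_expectation ::
    "'a measure \<Rightarrow> ('b \<Rightarrow> 'a measure) \<Rightarrow> ('a \<Rightarrow> real ^ 'n) \<Rightarrow> 'b \<Rightarrow> real ^ 'n \<Rightarrow> ('a \<Rightarrow> real) \<Rightarrow> real"
  where
  "cond_expectation \<mu> \<kappa> T y \<theta> f =
     (\<integral>x. f x \<partial>density (\<kappa> y) (\<lambda>x. ennreal (cond_density \<mu> \<kappa> T y \<theta> x)))"

text \<open>For \<open>\<theta>\<close> outside the natural parameter set one has \<open>\<psi>(\<theta>) = \<infinity>\<close>, hence
  \<open>log p(x, \<theta>) = -\<infinity>\<close>: such points of the constraint set (which is only contained in the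
  closure of the natural parameter set) carry the objective value \<open>\<infinity>\<close>.\<close>

definition em_objective ::
    "'a measure \<Rightarrow> ('b \<Rightarrow> 'a measure) \<Rightarrow> ('a \<Rightarrow> real ^ 'n) \<Rightarrow> 'b \<Rightarrow> real ^ 'n \<Rightarrow> real ^ 'n \<Rightarrow> ereal"
  where
  "em_objective \<mu> \<kappa> T y \<theta>\<^sub>0 \<theta> =
     (if \<theta> \<in> natural_params \<mu> T
      then ereal (- cond_expectation \<mu> \<kappa> T y \<theta>\<^sub>0 (\<lambda>x. ln (exp_density \<mu> T x \<theta>)))
      else \<infinity>)"

definition em_sequence ::
    "'a measure \<Rightarrow> ('b \<Rightarrow> 'a measure) \<Rightarrow> ('a \<Rightarrow> real ^ 'n) \<Rightarrow> 'b \<Rightarrow> (real ^ 'n) set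
      \<Rightarrow> (nat \<Rightarrow> real ^ 'n) \<Rightarrow> bool" where
  "em_sequence \<mu> \<kappa> T y M \<theta> \<longleftrightarrow>
     (\<forall>k. \<theta> k \<in> M) \<and>
     (\<forall>k. is_arg_min (em_objective \<mu> \<kappa> T y (\<theta> k)) (\<lambda>\<theta>. \<theta> \<in> M) (\<theta> (Suc k)))"


definition smallest_affine_support ::
    "'a measure \<Rightarrow> ('a \<Rightarrow> 'v::euclidean_space) \<Rightarrow> 'v set \<Rightarrow> bool" where
  "smallest_affine_support L T A \<longleftrightarrow>
     affine A \<and> (AE x in L. T x \<in> A) \<and>
     (\<forall>B. affine B \<and> (AE x in L. T x \<in> B) \<longrightarrow> A \<subseteq> B)"

definition orth_proj :: "'v::euclidean_space set \<Rightarrow> 'v \<Rightarrow> 'v" where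
  "orth_proj V x = (THE p. p \<in> V \<and> x - p \<in> orthogonal_comp V)"


text \<open>An o-minimal structure expanding the real field, in the axiomatization of van den Dries.
  \<open>S m\<close> is the collection of definable subsets of real \<open>m\<close>-space, whose points are the lists of
  length \<open>m\<close>. The intervals in the last axiom may be open, closed, half-open, unbounded or
  degenerate, so its right-hand side consists of the finite unions of points and open intervals;
  in particular real parameters are allowed in definitions.\<close>

locale o_minimal_structure =
  fixes S :: "nat \<Rightarrow> real list set set"
  assumes ambient: "A \<in> S m \<Longrightarrow> A \<subseteq> {xs. length xs = m}"
    and empty: "{} \<in> S m"
    and union: "A \<in> S m \<Longrightarrow> B \<in> S m \<Longrightarrow> A \<union> B \<in> S m"
    and compl: "A \<in> S m \<Longrightarrow> {xs. length xs = m} - A \<in> S m"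
    and cylinder_left: "A \<in> S m \<Longrightarrow> {x # xs | x xs. xs \<in> A} \<in> S (Suc m)"
    and cylinder_right: "A \<in> S m \<Longrightarrow> {xs @ [x] | x xs. xs \<in> A} \<in> S (Suc m)"
    and diagonal: "i < m \<Longrightarrow> j < m \<Longrightarrow> {xs. length xs = m \<and> xs ! i = xs ! j} \<in> S m"
    and projection: "A \<in> S (Suc m) \<Longrightarrow> butlast ` A \<in> S m"
    and less: "{[x, y] | x y. x < y} \<in> S 2"
    and plus: "{[x, y, x + y] | x y. True} \<in> S 3"
    and times: "{[x, y, x * y] | x y. True} \<in> S 3"
    and o_minimal:
      "S 1 = {(\<lambda>r. [r]) ` \<Union>F | F :: real set set. finite F \<and> (\<forall>I\<in>F. is_interval I)}"

text \<open>Points of \<^typ>\<open>real ^ 'n\<close> become lists via an enumeration \<open>e\<close> of the index type. As a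
  structure is closed under permutation of coordinates, the choice of \<open>e\<close> is irrelevant.\<close>

definition coords :: "(nat \<Rightarrow> 'n) \<Rightarrow> real ^ 'n \<Rightarrow> real list" where
  "coords e x = map (\<lambda>i. x $ e i) [0..<CARD('n)]"

definition definable :: "(nat \<Rightarrow> real list set set) \<Rightarrow> (real ^ 'n) set \<Rightarrow> bool" where
  "definable S A \<longleftrightarrow>
     (\<exists>e. bij_betw e {..<CARD('n)} (UNIV :: 'n set) \<and> coords e ` A \<in> S CARD('n))"

text \<open>A function is definable on \<open>D\<close> iff its graph over \<open>D\<close> is definable.\<close>

definition definable_fun ::
    "(nat \<Rightarrow> real list set set) \<Rightarrow> (real ^ 'n) set \<Rightarrow> (real ^ 'n \<Rightarrow> real) \<Rightarrow> bool" where
  "definable_fun S D f \<longleftrightarrow>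
     (\<exists>e. bij_betw e {..<CARD('n)} (UNIV :: 'n set) \<and>
          (\<lambda>x. coords e x @ [f x]) ` D \<in> S (Suc CARD('n)))"

end

theory Submission
  imports Defs
begin

text \<open>The conditional law of \<open>T\<close> given \<open>y\<close> depends on \<open>\<theta>\<close> only through \<open>P \<theta>\<close>, because \<open>\<theta>'' \<bullet> T\<close> is
  constant almost everywhere on the fibre. Hence the conditional mean \<open>m(\<theta>\<^sub>k)\<close> of \<open>T\<close> converges to a
  limit \<open>m*\<close> determined by \<open>\<theta>'*\<close>. Since the M-step minimizes \<open>\<psi>(\<theta>) - \<theta> \<bullet> m(\<theta>\<^sub>k)\<close> over \<open>M\<close>, every
  accumulation point of the sequence minimizes \<open>\<psi>(\<theta>) - \<theta> \<bullet> m*\<close> over \<open>M\<close> and lies in the convex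
  slice over \<open>\<theta>'*\<close>. As \<open>\<psi>\<close> is strictly convex for a minimal family, there is only one such point.\<close>

section \<open>Exponential integrals at interior parameters: majorants and continuity\<close>

text \<open>The norm is at most \<open>DIM('v)\<close> times the largest coordinate in absolute
  value, and one of the two signs removes the absolute value. This trades the norm for linear forms,
  whose exponentials are controlled by the natural parameter set.\<close>

lemma exp_norm_le_sum_Basis:
  fixes t :: "'v::euclidean_space" and d :: real
  assumes "0 \<le> d"
  shows "exp (d * norm t) \<le>
    (\<Sum>b\<in>Basis. exp (DIM('v) * d * (b \<bullet> t)) + exp (- (DIM('v) * d * (b \<bullet> t))))"
proof -
  obtain b where b: "b \<in> Basis" "\<And>c. c \<in> Basis \<Longrightarrow> \<bar>t \<bullet> c\<bar> \<le> \<bar>t \<bullet> b\<bar>"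
    using Max_in[of "(\<lambda>c. \<bar>t \<bullet> c\<bar>) ` Basis"] Max_ge[of "(\<lambda>c. \<bar>t \<bullet> c\<bar>) ` Basis"]
    by (auto simp del: Max_in Max_ge)
  have "norm t \<le> (\<Sum>c\<in>Basis. \<bar>t \<bullet> c\<bar>)"
    by (rule norm_le_l1)
  also have "\<dots> \<le> DIM('v) * \<bar>t \<bullet> b\<bar>"
    using b(2) by (rule sum_bounded_above)
  finally have "norm t \<le> DIM('v) * \<bar>b \<bullet> t\<bar>"
    by (simp add: inner_commute)
  from mult_left_mono[OF this assms] have "d * norm t \<le> DIM('v) * d * \<bar>b \<bullet> t\<bar>"
    by (simp only: mult_ac)
  hence "exp (d * norm t) \<le> exp (DIM('v) * d * \<bar>b \<bullet> t\<bar>)"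
    by simp
  also have "\<dots> \<le> exp (DIM('v) * d * (b \<bullet> t)) + exp (- (DIM('v) * d * (b \<bullet> t)))"
    by (cases "b \<bullet> t \<ge> 0") (simp_all add: abs_if)
  also have "\<dots> \<le> (\<Sum>b\<in>Basis. exp (DIM('v) * d * (b \<bullet> t)) + exp (- (DIM('v) * d * (b \<bullet> t))))"
    using b(1) by (intro member_le_sum) (auto intro: add_nonneg_nonneg)
  finally show ?thesis .
qed

lemma natural_params_iff_integrable:
  assumes [measurable]: "T \<in> borel_measurable L"
  shows "\<theta> \<in> natural_params L T \<longleftrightarrow> integrable L (\<lambda>x. exp (\<theta> \<bullet> T x))"
  by (simp add: natural_params_def integrable_iff_bounded)

text \<open>An interior parameter may be shifted both ways along every coordinate axis; the finite
  sum of the shifted exponentials is an integrable majorant.\<close>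

lemma integrable_exp_norm:
  fixes T :: "'a \<Rightarrow> real ^ 'n"
  assumes [measurable]: "T \<in> borel_measurable L"
    and l: "l \<in> interior (natural_params L T)"
  obtains d where "0 < d" "integrable L (\<lambda>x. exp (l \<bullet> T x + d * norm (T x)))"
proof -
  obtain e where e: "0 < e" "ball l e \<subseteq> natural_params L T"
    using l by (auto simp: mem_interior)
  \<comment> \<open>The factor \<open>DIM * d\<close> of the preceding bound becomes
    \<open>e / 2\<close>, so the shifted parameters stay in the ball of radius
    \<open>e\<close>.\<close>
  define d where "d = e / (2 * DIM(real ^ 'n))"
  have d: "0 < d" "real DIM(real ^ 'n) * d = e / 2"
    using e(1) by (simp_all add: d_def)
  have int: "integrable L (\<lambda>x. exp ((l + s *\<^sub>R b) \<bullet> T x))" if "b \<in> Basis" "\<bar>s\<bar> < e" for s b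
    using e(2) that by (subst natural_params_iff_integrable[symmetric]) (auto simp: dist_norm)
  have "integrable L (\<lambda>x. \<Sum>b\<in>Basis. exp ((l + (e / 2) *\<^sub>R b) \<bullet> T x) + exp ((l + (- e / 2) *\<^sub>R b) \<bullet> T x))"
    using e(1) by (intro Bochner_Integration.integrable_sum Bochner_Integration.integrable_add int) auto
  hence "integrable L (\<lambda>x. exp (l \<bullet> T x + d * norm (T x)))"
  proof (rule Bochner_Integration.integrable_bound)
    have "exp (l \<bullet> T x + d * norm (T x)) \<le>
      (\<Sum>b\<in>Basis. exp ((l + (e / 2) *\<^sub>R b) \<bullet> T x) + exp ((l + (- e / 2) *\<^sub>R b) \<bullet> T x))" for x
    proof -
      have "exp (l \<bullet> T x) * exp (d * norm (T x)) \<le> exp (l \<bullet> T x) *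
        (\<Sum>b\<in>Basis. exp (e / 2 * (b \<bullet> T x)) + exp (- (e / 2 * (b \<bullet> T x))))"
        using exp_norm_le_sum_Basis[of d "T x"] d(1) unfolding d(2) by simp
      thus ?thesis
        by (simp add: sum_distrib_left distrib_left inner_add_left inner_diff_left flip: exp_add)
    qed
    thus "AE x in L. norm (exp (l \<bullet> T x + d * norm (T x))) \<le> norm
      (\<Sum>b\<in>Basis. exp ((l + (e / 2) *\<^sub>R b) \<bullet> T x) + exp ((l + (- e / 2) *\<^sub>R b) \<bullet> T x))"
      by (simp add: order_trans[OF _ abs_ge_self])
  qed measurable
  thus ?thesis
    using d(1) that by blast
qed

text \<open>Dominated convergence with one majorant for all parameters near \<open>l\<close>. The
  bound on \<open>g\<close> admits both \<open>g = 1\<close> and \<open>g = T\<close>, the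
  denominator and numerator of a mean of \<open>T\<close>.\<close>

lemma
  fixes g :: "'a \<Rightarrow> 'c::{banach, second_countable_topology}"
  assumes T [measurable]: "T \<in> borel_measurable L" and g [measurable]: "g \<in> borel_measurable L"
    and bound: "\<And>x. norm (g x) \<le> 1 + norm (T x)"
    and l: "l \<in> interior (natural_params L T)"
  shows integrable_exp_scaleR: "integrable L (\<lambda>x. exp (l \<bullet> T x) *\<^sub>R g x)"
    and tendsto_integral_exp_scaleR: "\<theta> \<longlonglongrightarrow> l \<Longrightarrow>
      (\<lambda>k. \<integral>x. exp (\<theta> k \<bullet> T x) *\<^sub>R g x \<partial>L) \<longlonglongrightarrow> (\<integral>x. exp (l \<bullet> T x) *\<^sub>R g x \<partial>L)"
proof -
  obtain d where d: "0 < d" and int: "integrable L (\<lambda>x. exp (l \<bullet> T x + d * norm (T x)))"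
    by (rule integrable_exp_norm[OF T l])
  \<comment> \<open>The margin \<open>d\<close> is split: one half absorbs the displacement of the
    parameter, the other the linear growth of \<open>g\<close>, at the cost of the constant
    \<open>1 + 2 / d\<close>.\<close>
  define w where "w x = (1 + 2 / d) * exp (l \<bullet> T x + d * norm (T x))" for x
  have w: "integrable L w"
    using int unfolding w_def by simp
  have le: "norm (exp (\<eta> \<bullet> T x) *\<^sub>R g x) \<le> w x" if "dist \<eta> l \<le> d / 2" for \<eta> x
  proof -
    have "(\<eta> - l) \<bullet> T x \<le> norm (\<eta> - l) * norm (T x)"
      by (rule norm_cauchy_schwarz)
    also have "\<dots> \<le> d / 2 * norm (T x)"
      using that by (intro mult_right_mono) (auto simp: dist_norm)
    finally have 1: "exp (\<eta> \<bullet> T x) \<le> exp (l \<bullet> T x + d / 2 * norm (T x))"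
      by (simp add: inner_diff_left)
    have "1 + norm (T x) \<le> (1 + 2 / d) * (1 + d / 2 * norm (T x))"
      using d by (simp add: field_simps)
    also have "\<dots> \<le> (1 + 2 / d) * exp (d / 2 * norm (T x))"
      using d by (intro mult_left_mono exp_ge_add_one_self) auto
    finally have "norm (g x) \<le> (1 + 2 / d) * exp (d / 2 * norm (T x))"
      using bound[of x] by simp
    with 1 have "exp (\<eta> \<bullet> T x) * norm (g x) \<le>
        exp (l \<bullet> T x + d / 2 * norm (T x)) * ((1 + 2 / d) * exp (d / 2 * norm (T x)))"
      by (intro mult_mono) auto
    also have "\<dots> = (1 + 2 / d) * (exp (l \<bullet> T x + d / 2 * norm (T x)) * exp (d / 2 * norm (T x)))"
      by (simp only: mult_ac)
    also have "\<dots> = w x"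
      unfolding w_def exp_add[symmetric] by simp
    finally show ?thesis
      by simp
  qed
  show "integrable L (\<lambda>x. exp (l \<bullet> T x) *\<^sub>R g x)"
    using d by (intro Bochner_Integration.integrable_bound[OF w])
      (auto intro!: AE_I2 order_trans[OF le abs_ge_self] simp del: norm_scaleR)
  assume lim: "\<theta> \<longlonglongrightarrow> l"
  from d obtain k0 where k0: "\<And>k. k \<ge> k0 \<Longrightarrow> dist (\<theta> k) l \<le> d / 2"
    using metric_LIMSEQ_D[OF lim, of "d / 2"] by (auto intro: less_imp_le)
  have "(\<lambda>k. \<integral>x. exp (\<theta> (k + k0) \<bullet> T x) *\<^sub>R g x \<partial>L) \<longlonglongrightarrow> (\<integral>x. exp (l \<bullet> T x) *\<^sub>R g x \<partial>L)"
    using k0 by (intro integral_dominated_convergence[OF _ _ w])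
      (auto intro!: AE_I2 le tendsto_intros LIMSEQ_ignore_initial_segment[OF lim] simp del: norm_scaleR)
  thus "(\<lambda>k. \<integral>x. exp (\<theta> k \<bullet> T x) *\<^sub>R g x \<partial>L) \<longlonglongrightarrow> (\<integral>x. exp (l \<bullet> T x) *\<^sub>R g x \<partial>L)"
    by (rule LIMSEQ_offset)
qed

section \<open>Continuity and strict convexity of the log-partition function\<close>

lemma integral_exp_pos:
  assumes "integrable L (\<lambda>x. exp (f x))" and "emeasure L (space L) \<noteq> 0"
  shows "0 < (\<integral>x. exp (f x :: real) \<partial>L)"
proof -
  have "(\<integral>x. exp (f x) \<partial>L) \<noteq> 0"
  proof
    assume "(\<integral>x. exp (f x) \<partial>L) = 0"
    hence "AE x in L. exp (f x) = 0"
      using assms(1) by (subst (asm) integral_nonneg_eq_0_iff_AE) auto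
    hence "AE x in L. False"
      by simp
    hence "space L \<in> null_sets L"
      by (simp add: AE_iff_null_sets)
    thus False
      using assms(2) by auto
  qed
  moreover have "0 \<le> (\<integral>x. exp (f x) \<partial>L)"
    by simp
  ultimately show ?thesis
    by linarith
qed

lemma minimal_family_emeasure_space_nonzero:
  fixes T :: "'a \<Rightarrow> real ^ 'n"
  assumes "minimal_family \<mu> T"
  shows "emeasure \<mu> (space \<mu>) \<noteq> 0"
proof
  assume "emeasure \<mu> (space \<mu>) = 0"
  hence "AE x in \<mu>. P x" for P
    by (intro AE_I[where N = "space \<mu>"]) auto
  \<comment> \<open>Index types are nonempty, so a nonzero direction exists; on a null space it
    would violate minimality.\<close>
  moreover have "(1 :: real ^ 'n) \<noteq> 0"
    by (simp add: vec_eq_iff)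
  ultimately show False
    using assms unfolding minimal_family_def by blast
qed

lemma log_partition_tendsto:
  assumes T: "T \<in> borel_measurable \<mu>" and min: "minimal_family \<mu> T"
    and l: "l \<in> interior (natural_params \<mu> T)" and lim: "\<theta> \<longlonglongrightarrow> l"
  shows "(\<lambda>k. log_partition \<mu> T (\<theta> k)) \<longlonglongrightarrow> log_partition \<mu> T l"
proof -
  have "l \<in> natural_params \<mu> T"
    using l interior_subset by blast
  hence "0 < (\<integral>x. exp (l \<bullet> T x) \<partial>\<mu>)"
    using T minimal_family_emeasure_space_nonzero[OF min]
    by (intro integral_exp_pos) (simp_all add: natural_params_iff_integrable)
  moreover have "(\<lambda>k. \<integral>x. exp (\<theta> k \<bullet> T x) \<partial>\<mu>) \<longlonglongrightarrow> (\<integral>x. exp (l \<bullet> T x) \<partial>\<mu>)"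
    using tendsto_integral_exp_scaleR[OF T _ _ l lim, of "\<lambda>_. 1 :: real"] by simp
  ultimately show ?thesis
    unfolding log_partition_def by (intro tendsto_ln) auto
qed

text \<open>For the normalized densities at \<open>a\<close> and \<open>b\<close>, the arithmetic
  mean exceeds the geometric mean \<open>m\<close> by half the squared difference of their square
  roots. Integrating bounds the integral of \<open>m\<close> by 1; equality would make
  \<open>(a - b) \<bullet> T\<close> constant almost everywhere, against minimality.\<close>

lemma
  assumes T [measurable]: "T \<in> borel_measurable \<mu>" and min: "minimal_family \<mu> T"
    and a: "a \<in> natural_params \<mu> T" and b: "b \<in> natural_params \<mu> T"
  shows midpoint_in_natural_params: "midpoint a b \<in> natural_params \<mu> T"
    and log_partition_midpoint_less: "a \<noteq> b \<Longrightarrow>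
      log_partition \<mu> T (midpoint a b) < (log_partition \<mu> T a + log_partition \<mu> T b) / 2"
proof -
  let ?\<psi> = "log_partition \<mu> T"
  define f where "f c x = exp (c \<bullet> T x - ?\<psi> c)" for c x
  define r where "r c x = exp ((c \<bullet> T x - ?\<psi> c) / 2)" for c x
  have exp_int: "(\<integral>x. exp (c \<bullet> T x) \<partial>\<mu>) = exp (?\<psi> c)" "integrable \<mu> (\<lambda>x. exp (c \<bullet> T x))"
    if "c \<in> natural_params \<mu> T" for c
    using that minimal_family_emeasure_space_nonzero[OF min] integral_exp_pos[of \<mu> "\<lambda>x. c \<bullet> T x"]
    by (simp_all add: natural_params_iff_integrable log_partition_def)
  have f: "integrable \<mu> (f c)" "(\<integral>x. f c x \<partial>\<mu>) = 1" if "c \<in> natural_params \<mu> T" for c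
    using exp_int[OF that] by (simp_all add: f_def[abs_def] exp_diff)
  have sq: "f c x = (r c x)\<^sup>2" for c x
    by (simp add: f_def r_def flip: exp_double)
  define m where "m x = exp (midpoint a b \<bullet> T x - (?\<psi> a + ?\<psi> b) / 2)" for x
  have m: "m x = r a x * r b x" for x
    by (simp add: m_def r_def midpoint_def inner_add_left field_simps flip: exp_add)
  have gap: "(f a x + f b x) / 2 - m x = (r a x - r b x)\<^sup>2 / 2" for x
    by (simp add: sq m power2_diff field_simps)
  have fab: "integrable \<mu> (\<lambda>x. (f a x + f b x) / 2)"
    using f(1) a b by simp
  have mint: "integrable \<mu> m"
  proof (rule Bochner_Integration.integrable_bound[OF fab])
    have "norm (m x) \<le> norm ((f a x + f b x) / 2)" for x
    proof -
      have "m x \<le> (f a x + f b x) / 2"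
        using gap[of x] zero_le_power2[of "r a x - r b x"] by linarith
      moreover have "0 \<le> m x"
        by (simp add: m_def)
      ultimately show ?thesis by simp
    qed
    thus "AE x in \<mu>. norm (m x) \<le> norm ((f a x + f b x) / 2)"
      by simp
  qed (simp add: m_def[abs_def])
  \<comment> \<open>Up to this constant factor, \<open>m\<close> is the unnormalized density at the
    midpoint.\<close>
  have "integrable \<mu> (\<lambda>x. exp ((?\<psi> a + ?\<psi> b) / 2) * m x)"
    using mint by simp
  also have "(\<lambda>x. exp ((?\<psi> a + ?\<psi> b) / 2) * m x) = (\<lambda>x. exp (midpoint a b \<bullet> T x))"
    by (simp add: m_def flip: exp_add)
  finally show mid: "midpoint a b \<in> natural_params \<mu> T"
    by (simp add: natural_params_iff_integrable)
  assume "a \<noteq> b"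
  have "(\<integral>x. (r a x - r b x)\<^sup>2 / 2 \<partial>\<mu>) \<noteq> 0"
  proof
    assume "(\<integral>x. (r a x - r b x)\<^sup>2 / 2 \<partial>\<mu>) = 0"
    hence "AE x in \<mu>. (r a x - r b x)\<^sup>2 / 2 = 0"
      using Bochner_Integration.integrable_diff[OF fab mint]
      by (subst (asm) integral_nonneg_eq_0_iff_AE) (auto simp: gap)
    hence "AE x in \<mu>. (a - b) \<bullet> T x = ?\<psi> a - ?\<psi> b"
      by eventually_elim (simp add: r_def inner_diff_left)
    thus False
      using min \<open>a \<noteq> b\<close> unfolding minimal_family_def by (metis right_minus_eq)
  qed
  moreover have "0 \<le> (\<integral>x. (r a x - r b x)\<^sup>2 / 2 \<partial>\<mu>)"
    by simp
  moreover have "(\<integral>x. (r a x - r b x)\<^sup>2 / 2 \<partial>\<mu>) = 1 - (\<integral>x. m x \<partial>\<mu>)"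
    using f a b mint by (simp add: fab flip: gap)
  ultimately have "(\<integral>x. m x \<partial>\<mu>) < 1"
    by linarith
  moreover have "(\<integral>x. m x \<partial>\<mu>) = exp (?\<psi> (midpoint a b) - (?\<psi> a + ?\<psi> b) / 2)"
    using exp_int(1)[OF mid] by (simp add: m_def exp_diff)
  ultimately show "?\<psi> (midpoint a b) < (?\<psi> a + ?\<psi> b) / 2"
    by simp
qed

section \<open>The conditional mean of the statistic and the EM objective\<close>

text \<open>With \<open>L = \<kappa> y\<close> this is the conditional mean of \<open>T\<close>
  given \<open>y\<close>; the log-partition factor has cancelled in the quotient.\<close>

definition tilted_mean :: "'a measure \<Rightarrow> ('a \<Rightarrow> real ^ 'n) \<Rightarrow> real ^ 'n \<Rightarrow> real ^ 'n" where
  "tilted_mean L T \<theta> = (\<integral>x. exp (\<theta> \<bullet> T x) *\<^sub>R T x \<partial>L) /\<^sub>R (\<integral>x. exp (\<theta> \<bullet> T x) \<partial>L)"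

lemma tilted_mean_tendsto:
  assumes T: "T \<in> borel_measurable L" and L: "emeasure L (space L) \<noteq> 0"
    and l: "l \<in> interior (natural_params L T)" and lim: "\<theta> \<longlonglongrightarrow> l"
  shows "(\<lambda>k. tilted_mean L T (\<theta> k)) \<longlonglongrightarrow> tilted_mean L T l"
proof -
  have "l \<in> natural_params L T"
    using l interior_subset by blast
  hence "0 < (\<integral>x. exp (l \<bullet> T x) \<partial>L)"
    using T L by (intro integral_exp_pos) (simp_all add: natural_params_iff_integrable)
  moreover have "(\<lambda>k. \<integral>x. exp (\<theta> k \<bullet> T x) \<partial>L) \<longlonglongrightarrow> (\<integral>x. exp (l \<bullet> T x) \<partial>L)"
    using tendsto_integral_exp_scaleR[OF T _ _ l lim, of "\<lambda>_. 1 :: real"] by simp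
  moreover have "(\<lambda>k. \<integral>x. exp (\<theta> k \<bullet> T x) *\<^sub>R T x \<partial>L) \<longlonglongrightarrow> (\<integral>x. exp (l \<bullet> T x) *\<^sub>R T x \<partial>L)"
    using tendsto_integral_exp_scaleR[OF T T _ l lim] by simp
  ultimately show ?thesis
    unfolding tilted_mean_def by (intro tendsto_intros) auto
qed

text \<open>Numerator and denominator both acquire the factor \<open>exp c\<close>, which cancels.
  This is how the spare parameter drops out.\<close>

lemma tilted_mean_cong_spare:
  assumes [measurable]: "T \<in> borel_measurable L" and AE: "AE x in L. (a - b) \<bullet> T x = c"
  shows "tilted_mean L T a = tilted_mean L T b"
proof -
  have AE': "AE x in L. exp (a \<bullet> T x) = exp c * exp (b \<bullet> T x)"
    using AE by eventually_elim (simp add: inner_diff_left algebra_simps flip: exp_add)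
  have "(\<integral>x. exp (a \<bullet> T x) \<partial>L) = (\<integral>x. exp c * exp (b \<bullet> T x) \<partial>L)"
    using AE' by (intro integral_cong_AE) auto
  moreover have "(\<integral>x. exp (a \<bullet> T x) *\<^sub>R T x \<partial>L) = (\<integral>x. exp c *\<^sub>R (exp (b \<bullet> T x) *\<^sub>R T x) \<partial>L)"
    using AE' by (intro integral_cong_AE) auto
  ultimately show ?thesis
    by (simp add: tilted_mean_def del: scaleR_scaleR) simp
qed

text \<open>The log-partition factor is constant in \<open>x\<close>. The result lets the continuity
  lemmas be applied to the fibre measure.\<close>

lemma natural_params_fibre:
  assumes [measurable]: "T \<in> borel_measurable (\<kappa> y)"
    and fin: "incomplete_density \<mu> \<kappa> T y \<theta> < \<infinity>"
  shows "\<theta> \<in> natural_params (\<kappa> y) T"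
proof -
  let ?\<psi> = "log_partition \<mu> T \<theta>"
  have "integrable (\<kappa> y) (\<lambda>x. exp (\<theta> \<bullet> T x - ?\<psi>))"
    using fin by (simp add: integrable_iff_bounded incomplete_density_def exp_density_def)
  hence "integrable (\<kappa> y) (\<lambda>x. exp ?\<psi> * exp (\<theta> \<bullet> T x - ?\<psi>))"
    by simp
  thus ?thesis
    by (simp add: natural_params_iff_integrable flip: exp_add)
qed

text \<open>The log-density is affine in \<open>T\<close>, so only its conditional mean enters: the
  M-step minimizes the log-partition function minus a linear form.\<close>

lemma em_objective_eq:
  assumes T [measurable]: "T \<in> borel_measurable (\<kappa> y)"
    and pos: "emeasure (\<kappa> y) (space (\<kappa> y)) \<noteq> 0"
    and \<theta>\<^sub>0: "\<theta>\<^sub>0 \<in> interior (natural_params (\<kappa> y) T)" and \<theta>: "\<theta> \<in> natural_params \<mu> T"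
  shows "em_objective \<mu> \<kappa> T y \<theta>\<^sub>0 \<theta> =
    ereal (log_partition \<mu> T \<theta> - \<theta> \<bullet> tilted_mean (\<kappa> y) T \<theta>\<^sub>0)"
proof -
  let ?L = "\<kappa> y" and ?\<psi> = "log_partition \<mu> T"
  let ?Z = "\<integral>x. exp (\<theta>\<^sub>0 \<bullet> T x) \<partial>?L"
  have "\<theta>\<^sub>0 \<in> natural_params ?L T"
    using \<theta>\<^sub>0 interior_subset by blast
  hence int: "integrable ?L (\<lambda>x. exp (\<theta>\<^sub>0 \<bullet> T x))"
    by (simp add: natural_params_iff_integrable)
  hence Z: "0 < ?Z"
    using pos by (rule integral_exp_pos)
  have intT: "integrable ?L (\<lambda>x. exp (\<theta>\<^sub>0 \<bullet> T x) *\<^sub>R T x)"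
    using integrable_exp_scaleR[OF T T _ \<theta>\<^sub>0] by simp
  have "incomplete_density \<mu> \<kappa> T y \<theta>\<^sub>0 = ennreal (\<integral>x. exp (\<theta>\<^sub>0 \<bullet> T x - ?\<psi> \<theta>\<^sub>0) \<partial>?L)"
    unfolding incomplete_density_def exp_density_def
    using int by (intro nn_integral_eq_integral) (simp_all add: exp_diff)
  also have "(\<integral>x. exp (\<theta>\<^sub>0 \<bullet> T x - ?\<psi> \<theta>\<^sub>0) \<partial>?L) = ?Z / exp (?\<psi> \<theta>\<^sub>0)"
    by (simp add: exp_diff)
  finally have cond: "cond_density \<mu> \<kappa> T y \<theta>\<^sub>0 x = exp (\<theta>\<^sub>0 \<bullet> T x) / ?Z" for x
    using Z by (simp add: cond_density_def exp_density_def exp_diff)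
  have "cond_expectation \<mu> \<kappa> T y \<theta>\<^sub>0 (\<lambda>x. ln (exp_density \<mu> T x \<theta>)) =
      (\<integral>x. exp (\<theta>\<^sub>0 \<bullet> T x) / ?Z * (\<theta> \<bullet> T x - ?\<psi> \<theta>) \<partial>?L)"
    unfolding cond_expectation_def cond exp_density_def using Z
    by (subst integral_density) auto
  also have "\<dots> = (\<integral>x. (\<theta> \<bullet> (exp (\<theta>\<^sub>0 \<bullet> T x) *\<^sub>R T x)) / ?Z - exp (\<theta>\<^sub>0 \<bullet> T x) * (?\<psi> \<theta> / ?Z) \<partial>?L)"
    by (intro Bochner_Integration.integral_cong) (simp_all add: algebra_simps diff_divide_distrib)
  also have "\<dots> = \<theta> \<bullet> (\<integral>x. exp (\<theta>\<^sub>0 \<bullet> T x) *\<^sub>R T x \<partial>?L) / ?Z - ?Z * (?\<psi> \<theta> / ?Z)"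
    using int intT by (subst Bochner_Integration.integral_diff) (simp_all del: inner_scaleR_right)
  also have "\<dots> = \<theta> \<bullet> tilted_mean ?L T \<theta>\<^sub>0 - ?\<psi> \<theta>"
    using Z by (simp add: tilted_mean_def divide_inverse_commute)
  finally show ?thesis
    using \<theta> by (simp add: em_objective_def)
qed

section \<open>Accumulation points of bounded sequences, and orthogonal projection\<close>

text \<open>If the sequence fails to tend to \<open>a\<close>, infinitely many terms keep a fixed
  distance from \<open>a\<close>, and by compactness they accumulate at a second point.\<close>

lemma convergent_if_unique_accumulation_point:
  fixes f :: "nat \<Rightarrow> 'v::euclidean_space"
  assumes bdd: "bounded (range f)"
    and unique: "\<And>r s a b. strict_mono r \<Longrightarrow> (f \<circ> r) \<longlonglongrightarrow> a \<Longrightarrow>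
      strict_mono s \<Longrightarrow> (f \<circ> s) \<longlonglongrightarrow> b \<Longrightarrow> a = b"
  shows "convergent f"
proof -
  obtain a r where r: "strict_mono r" "(f \<circ> r) \<longlonglongrightarrow> a"
    using bounded_imp_convergent_subsequence[OF bdd] by blast
  have "f \<longlonglongrightarrow> a"
  proof (rule ccontr)
    assume "\<not> f \<longlonglongrightarrow> a"
    then obtain e where e: "0 < e" "\<And>n. \<exists>k\<ge>n. e \<le> dist (f k) a"
      unfolding lim_sequentially by (metis not_le)
    define B where "B = {k. e \<le> dist (f k) a}"
    have "infinite B"
      using e(2) by (auto simp: B_def infinite_nat_iff_unbounded_le)
    hence B: "strict_mono (enumerate B)" "\<And>k. enumerate B k \<in> B"
      by (simp_all add: strict_mono_enumerate enumerate_in_set)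
    have "bounded (range (f \<circ> enumerate B))"
      by (rule bounded_subset[OF bdd]) auto
    then obtain b s where s: "strict_mono s" "(f \<circ> enumerate B \<circ> s) \<longlonglongrightarrow> b"
      using bounded_imp_convergent_subsequence by blast
    have "a = b"
      using unique[OF r, of "enumerate B \<circ> s" b] s B(1)
      by (simp add: strict_mono_o o_assoc)
    with s(2) e(1) obtain k where "dist ((f \<circ> enumerate B \<circ> s) k) a < e"
      using metric_LIMSEQ_D by blast
    thus False
      using B(2)[of "s k"] by (simp add: B_def)
  qed
  thus ?thesis
    by (rule convergentI)
qed

text \<open>Since \<open>orth_proj\<close> is a definite description, existence and uniqueness of
  the decomposition must be shown first.\<close>

lemma orth_proj_residual:
  assumes "subspace V"
  shows "x - orth_proj V x \<in> orthogonal_comp V"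
proof -
  obtain p q where "p \<in> V" "\<And>w. w \<in> V \<Longrightarrow> orthogonal q w" "x = p + q"
    using orthogonal_subspace_decomp_exists[of V x] assms by (metis span_eq_iff)
  hence pq: "p \<in> V" "x - p \<in> orthogonal_comp V"
    by (auto simp: orthogonal_comp_def orthogonal_commute)
  have "\<exists>!p. p \<in> V \<and> x - p \<in> orthogonal_comp V"
  proof (rule ex1I[of _ p])
    show "p \<in> V \<and> x - p \<in> orthogonal_comp V"
      using pq by simp
    fix p' assume p': "p' \<in> V \<and> x - p' \<in> orthogonal_comp V"
    have "p - p' \<in> V"
      using assms pq(1) p' by (simp add: subspace_diff)
    moreover have "(x - p') - (x - p) \<in> orthogonal_comp V"
      using subspace_diff[OF subspace_orthogonal_comp conjunct2[OF p'] pq(2)] .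
    ultimately have "orthogonal (p - p') (p - p')"
      by (simp add: orthogonal_comp_def)
    thus "p' = p"
      by (simp add: orthogonal_self)
  qed
  from theI'[OF this] show ?thesis
    by (simp add: orth_proj_def)
qed

section \<open>Uniqueness of the accumulation point of the EM sequence\<close>

theorem theorem3:
  fixes \<mu> :: "'a measure" and N :: "'b measure" and h :: "'a \<Rightarrow> 'b"
    and \<kappa> :: "'b \<Rightarrow> 'a measure" and T :: "'a \<Rightarrow> real ^ 'n" and y :: 'b
    and \<Theta> M V :: "(real ^ 'n) set" and t\<^sub>0 \<theta>' :: "real ^ 'n"
    and S :: "nat \<Rightarrow> real list set set" and \<theta> :: "nat \<Rightarrow> real ^ 'n"
  assumes "sigma_finite_measure \<mu>" and "h \<in> measurable \<mu> N"
    and "disintegration \<mu> N h \<kappa>"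
    and "T \<in> borel_measurable \<mu>"
    and \<Theta>: "\<Theta> = natural_params \<mu> T" and "aff_dim \<Theta> = int CARD('n)"
    and "minimal_family \<mu> T"
    and "y \<in> space N"
    and "\<And>\<theta>. \<theta> \<in> \<Theta> \<Longrightarrow> 0 < incomplete_density \<mu> \<kappa> T y \<theta> \<and> incomplete_density \<mu> \<kappa> T y \<theta> < \<infinity>"
    and "subspace V" and "t\<^sub>0 \<in> orthogonal_comp V"
    and "smallest_affine_support (\<kappa> y) T ((+) t\<^sub>0 ` V)"
    and "closed M" and "M \<subseteq> closure \<Theta>"
    and "o_minimal_structure S" and "definable S M"
    and "definable_fun S \<Theta> (neg_log_incomplete_density \<mu> \<kappa> T y)"
    and "em_sequence \<mu> \<kappa> T y M \<theta>" and "bounded (range \<theta>)"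
    and "\<And>k. \<theta> k \<in> interior \<Theta>"
    and "\<And>r l. strict_mono r \<Longrightarrow> (\<theta> \<circ> r) \<longlonglongrightarrow> l \<Longrightarrow> l \<in> interior \<Theta>"
    and "(\<lambda>k. orth_proj V (\<theta> k)) \<longlonglongrightarrow> \<theta>'"
    and "convex {\<theta>''. \<theta>'' \<in> orthogonal_comp V \<and> \<theta>' + \<theta>'' \<in> M}"
  shows "convergent \<theta>"
proof (rule convergent_if_unique_accumulation_point)
  let ?L = "\<kappa> y"
  let ?\<psi> = "log_partition \<mu> T" and ?m = "tilted_mean ?L T"
  note min = \<open>minimal_family \<mu> T\<close> and T = \<open>T \<in> borel_measurable \<mu>\<close>
  note density = assms(9)
  have sets: "sets ?L = sets \<mu>"
    using assms(3,8) by (auto simp: disintegration_def)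
  have TL: "T \<in> borel_measurable ?L"
    using T by (simp cong: measurable_cong_sets add: sets)
  have \<theta>_int: "\<theta> k \<in> interior \<Theta>" for k
    by fact
  \<comment> \<open>A null fibre measure would make the incomplete density at
    \<open>\<theta> 0\<close> vanish.\<close>
  have L: "emeasure ?L (space ?L) \<noteq> 0"
  proof
    assume "emeasure ?L (space ?L) = 0"
    hence "AE x in ?L. ennreal (exp_density \<mu> T x (\<theta> 0)) = 0"
      by (intro AE_I[where N = "space ?L"]) auto
    hence "incomplete_density \<mu> \<kappa> T y (\<theta> 0) = (\<integral>\<^sup>+x. 0 \<partial>?L)"
      unfolding incomplete_density_def by (rule nn_integral_cong_AE)
    moreover have "0 < incomplete_density \<mu> \<kappa> T y (\<theta> 0)"
      using density \<theta>_int interior_subset by blast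
    ultimately show False
      by simp
  qed
  have "\<Theta> \<subseteq> natural_params ?L T"
    using density natural_params_fibre[where \<kappa> = \<kappa> and y = y, OF TL] by blast
  hence int_sub: "interior \<Theta> \<subseteq> interior (natural_params ?L T)"
    by (rule interior_mono)
  have M_\<theta>: "\<theta> k \<in> M" for k
    using assms(18) by (simp add: em_sequence_def)
  \<comment> \<open>Both parameters lie in \<open>\<Theta>\<close>, so both objective values are
    finite and the inequality can be read in the reals.\<close>
  have step: "?\<psi> (\<theta> (Suc k)) - \<theta> (Suc k) \<bullet> ?m (\<theta> k) \<le> ?\<psi> \<eta> - \<eta> \<bullet> ?m (\<theta> k)"
    if "\<eta> \<in> M" "\<eta> \<in> \<Theta>" for k \<eta>
  proof -
    have "is_arg_min (em_objective \<mu> \<kappa> T y (\<theta> k)) (\<lambda>\<theta>. \<theta> \<in> M) (\<theta> (Suc k))"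
      using assms(18) by (simp add: em_sequence_def)
    hence "em_objective \<mu> \<kappa> T y (\<theta> k) (\<theta> (Suc k)) \<le> em_objective \<mu> \<kappa> T y (\<theta> k) \<eta>"
      using that(1) by (auto simp: is_arg_min_def not_less)
    moreover have "\<theta> (Suc k) \<in> natural_params \<mu> T"
      using \<theta>_int interior_subset \<Theta> by blast
    ultimately show ?thesis
      using that(2) \<theta>_int[of k] int_sub \<Theta> em_objective_eq[where \<mu> = \<mu> and \<kappa> = \<kappa> and y = y, OF TL L]
      by (auto simp: subset_iff)
  qed
  have acc_M: "l \<in> M" and acc_int: "l \<in> interior \<Theta>" and acc_proj: "l - \<theta>' \<in> orthogonal_comp V"
    if r: "strict_mono r" and l: "(\<theta> \<circ> r) \<longlonglongrightarrow> l" for r l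
  proof -
    show "l \<in> M"
      by (rule closed_sequentially[OF \<open>closed M\<close> _ l]) (simp add: M_\<theta>)
    show "l \<in> interior \<Theta>"
      using r l by fact
    \<comment> \<open>The spare parts lie in the closed subspace \<open>orthogonal_comp V\<close>,
      hence so does their limit.\<close>
    have lim: "(\<lambda>k. \<theta> (r k) - orth_proj V (\<theta> (r k))) \<longlonglongrightarrow> l - \<theta>'"
      using l LIMSEQ_subseq_LIMSEQ[OF assms(22) r] by (intro tendsto_diff) (simp_all add: o_def)
    show "l - \<theta>' \<in> orthogonal_comp V"
      by (rule closed_sequentially[OF closed_subspace[OF subspace_orthogonal_comp] _ lim])
        (simp add: orth_proj_residual[OF \<open>subspace V\<close>])
  qed
  \<comment> \<open>\<open>a - b\<close> is orthogonal to \<open>V\<close>, while \<open>T\<close>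
    lies in \<open>t\<^sub>0 + V\<close> almost everywhere on the fibre.\<close>
  have m_eq: "?m a = ?m b"
    if ab: "a - \<theta>' \<in> orthogonal_comp V" "b - \<theta>' \<in> orthogonal_comp V" for a b
  proof (rule tilted_mean_cong_spare[OF TL])
    have "(a - \<theta>') - (b - \<theta>') \<in> orthogonal_comp V"
      by (rule subspace_diff[OF subspace_orthogonal_comp ab])
    hence orth: "(a - b) \<bullet> v = 0" if "v \<in> V" for v
      using that by (auto simp: orthogonal_comp_def orthogonal_def inner_commute)
    have "AE x in ?L. T x \<in> (+) t\<^sub>0 ` V"
      using assms(12) by (simp add: smallest_affine_support_def)
    thus "AE x in ?L. (a - b) \<bullet> T x = (a - b) \<bullet> t\<^sub>0"
      by eventually_elim (auto simp: inner_add_right orth)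
  qed
  have acc_min: "?\<psi> l - l \<bullet> ?m l \<le> ?\<psi> \<eta> - \<eta> \<bullet> ?m l"
    if r: "strict_mono r" and l: "(\<theta> \<circ> r) \<longlonglongrightarrow> l" and \<eta>: "\<eta> \<in> M" "\<eta> \<in> \<Theta>" for r l \<eta>
  proof -
    \<comment> \<open>The predecessors of the subsequence may accumulate elsewhere, but only at points with the
      same accurate parameter.\<close>
    define p where "p k = r (Suc k) - 1" for k
    \<comment> \<open>Starting at \<open>r (Suc k) > r 0\<close> keeps the subtraction on naturals
      from truncating.\<close>
    have p: "Suc (p k) = r (Suc k)" for k
      using strict_monoD[OF r, of 0 "Suc k"] by (simp add: p_def)
    have "strict_mono p"
    proof (rule strict_monoI)
      fix i j :: nat
      assume "i < j"
      hence "Suc (p i) < Suc (p j)"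
        unfolding p by (intro strict_monoD[OF r]) simp
      thus "p i < p j"
        by simp
    qed
    have "bounded (range (\<theta> \<circ> p))"
      by (rule bounded_subset[OF \<open>bounded (range \<theta>)\<close>]) auto
    then obtain b s where s: "strict_mono s" "(\<theta> \<circ> p \<circ> s) \<longlonglongrightarrow> b"
      using bounded_imp_convergent_subsequence by blast
    have ps: "strict_mono (p \<circ> s)" "(\<theta> \<circ> (p \<circ> s)) \<longlonglongrightarrow> b"
      using s \<open>strict_mono p\<close> by (auto simp: strict_mono_o o_assoc)
    \<comment> \<open>Continuity is used at \<open>b\<close>, the limit of the predecessors;
      \<open>m_eq\<close> then replaces \<open>b\<close> by \<open>l\<close>.\<close>
    have "(\<lambda>k. ?m (\<theta> (p (s k)))) \<longlonglongrightarrow> ?m b"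
      using tilted_mean_tendsto[OF TL L _ ps(2)] acc_int[OF ps] int_sub by (auto simp: o_def)
    also have "?m b = ?m l"
      using acc_proj[OF ps] acc_proj[OF r l] by (rule m_eq)
    finally have m_lim: "(\<lambda>k. ?m (\<theta> (p (s k)))) \<longlonglongrightarrow> ?m l" .
    have "(\<lambda>k. \<theta> (r (Suc k))) \<longlonglongrightarrow> l"
      using LIMSEQ_Suc[OF l] by (simp add: o_def)
    from LIMSEQ_subseq_LIMSEQ[OF this s(1)] have l': "(\<lambda>k. \<theta> (Suc (p (s k)))) \<longlonglongrightarrow> l"
      by (simp add: o_def p)
    have "(\<lambda>k. ?\<psi> (\<theta> (Suc (p (s k))))) \<longlonglongrightarrow> ?\<psi> l"
      using log_partition_tendsto[OF T min _ l'] acc_int[OF r l] \<Theta> by simp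
    hence "(\<lambda>k. ?\<psi> (\<theta> (Suc (p (s k)))) - \<theta> (Suc (p (s k))) \<bullet> ?m (\<theta> (p (s k))))
        \<longlonglongrightarrow> ?\<psi> l - l \<bullet> ?m l"
      by (intro tendsto_intros l' m_lim)
    moreover have "(\<lambda>k. ?\<psi> \<eta> - \<eta> \<bullet> ?m (\<theta> (p (s k)))) \<longlonglongrightarrow> ?\<psi> \<eta> - \<eta> \<bullet> ?m l"
      by (intro tendsto_intros m_lim)
    ultimately show ?thesis
      by (rule LIMSEQ_le) (use step[OF \<eta>] in blast)
  qed
  fix r s a b
  assume r: "strict_mono r" "(\<theta> \<circ> r) \<longlonglongrightarrow> a" and s: "strict_mono s" "(\<theta> \<circ> s) \<longlonglongrightarrow> b"
  have a: "a \<in> M" "a \<in> \<Theta>" "a - \<theta>' \<in> orthogonal_comp V"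
    using acc_M[OF r] acc_int[OF r] acc_proj[OF r] interior_subset by auto
  have b: "b \<in> M" "b \<in> \<Theta>" "b - \<theta>' \<in> orthogonal_comp V"
    using acc_M[OF s] acc_int[OF s] acc_proj[OF s] interior_subset by auto
  \<comment> \<open>Convexity is available only for the slice, so it is applied to the spare parts
    of \<open>a\<close> and \<open>b\<close>.\<close>
  have "(1 / 2) *\<^sub>R (a - \<theta>') + (1 / 2) *\<^sub>R (b - \<theta>')
      \<in> {\<theta>''. \<theta>'' \<in> orthogonal_comp V \<and> \<theta>' + \<theta>'' \<in> M}"
    using a b by (intro convexD[OF assms(23)]) auto
  moreover have "\<theta>' + ((1 / 2) *\<^sub>R (a - \<theta>') + (1 / 2) *\<^sub>R (b - \<theta>')) = midpoint a b"
    by (simp add: midpoint_def vec_eq_iff field_simps)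
  ultimately have mid_M: "midpoint a b \<in> M"
    by simp
  show "a = b"
  proof (rule ccontr)
    assume "a \<noteq> b"
    have mid: "midpoint a b \<in> \<Theta>"
      using midpoint_in_natural_params[OF T min] a b \<Theta> by blast
    have "?\<psi> (midpoint a b) < (?\<psi> a + ?\<psi> b) / 2"
      using log_partition_midpoint_less[OF T min] a b \<Theta> \<open>a \<noteq> b\<close> by blast
    moreover have "?\<psi> a - a \<bullet> ?m a \<le> ?\<psi> (midpoint a b) - midpoint a b \<bullet> ?m a"
      using acc_min[OF r mid_M mid] .
    \<comment> \<open>By \<open>m_eq\<close>, \<open>a\<close> and \<open>b\<close> minimize the
      same function; averaging the two inequalities contradicts strict convexity at the
      midpoint.\<close>
    moreover have "?\<psi> b - b \<bullet> ?m a \<le> ?\<psi> (midpoint a b) - midpoint a b \<bullet> ?m a"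
      using acc_min[OF s mid_M mid] m_eq[OF a(3) b(3)] by simp
    moreover have "midpoint a b \<bullet> ?m a = (a \<bullet> ?m a + b \<bullet> ?m a) / 2"
      by (simp add: midpoint_def inner_add_left)
    ultimately show False
      by argo
  qed
qed fact

end
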